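(* Let $y=(y_w)_{w\in\langle\underline X\rangle}$ be a tracial sequence and let $t:=\operatorname{rank}M(y)$. Suppose that for some $N\in\mathbb N$ with $\operatorname{rank}M_N(y)=t$, the matrix $M_N(y)$ is positive semidefinite and $M_{N+1}(y)$ is a flat extension of $M_N(y)$. Then $y$ has a tracial moment representation with matrices of size at most $t$, i.e. there are finitely many tuples $\underline A^{(i)}=(A^{(i)}_1,\dots,A^{(i)}_n)$ of real symmetric matrices of size at most $t$ (all matrices within one tuple having the same size) and $\lambda_i\in\mathbb R_{\ge0}$ with $\sum_i\lambda_i=1$ such that $y_w=\sum_i\lambda_i\operatorname{Tr}(w(\underline A^{(i)}))$ for all $w\in\langle\underline X\rangle$.
   Context: Let $\langle\underline X\rangle$ be the free monoid of words in the non-commuting letters $\underline X=(X_1,\dots,X_n)$, with empty word $\emptyset=1$. For a word $w$, $w^*$ is the reversed word and $\deg w$ its length. Two words are cyclically equivalent, $w\overset{\mathrm{cyc}}{\sim}u$, if $u$ is a cyclic permutation of $w$. $w(\underline A)$ denotes evaluation of $w$ at a tuple of square matrices of equal size, and $\operatorname{Tr}(A)=\frac1s\operatorname{tr}(A)$ for $A\in\mathbb R^{s\times s}$ is the normalized trace. A tracial sequence is a family of real numbers $(y_w)_{w\in\langle\underline X\rangle}$ with $y_w=y_u$ whenever $w\overset{\mathrm{cyc}}{\sim}u$, $y_w=y_{w^*}$ for all $w$, and $y_\emptyset=1$. Its tracial moment matrix is the infinite matrix $M(y)=(y_{u^*v})_{u,v\in\langle\underline X\rangle}$, whose rank is the dimension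 of the span of its columns; $M_k(y)$ is the finite submatrix indexed by words $u,v$ with $\deg u,\deg v\le k$. A symmetric matrix $\tilde A=\begin{pmatrix} A & B \\ {B}^* & C \end{pmatrix}$ is a flat extension of the symmetric matrix $A$ if $\operatorname{rank}A=\operatorname{rank}\tilde A$. *)

theory Defs
  imports Complex_Main "HOL-Library.Extended_Nat" "HOL-Library.Function_Algebras"
    "Jordan_Normal_Form.Matrix"
begin

text \<open>Pointwise scalar multiplication, so that \<open>span\<close> and \<open>dim\<close> apply to possibly infinite columns.\<close>

instantiation "fun" :: (type, real_vector) real_vector
begin

definition scaleR_fun :: "real \<Rightarrow> ('a \<Rightarrow> 'b) \<Rightarrow> 'a \<Rightarrow> 'b" where
  "scaleR_fun c f = (\<lambda>x. c *\<^sub>R f x)"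

instance
  by standard (simp_all add: scaleR_fun_def fun_eq_iff scaleR_add_right scaleR_add_left)

end

text \<open>
  A real matrix with rows and columns indexed by a (possibly infinite) set \<open>I\<close> is given by \<open>I\<close>
  together with an entry function; values outside \<open>I\<close> are irrelevant.  A column is encoded as a
  function that vanishes off \<open>I\<close>.
\<close>

definition columns_on :: "'a set \<Rightarrow> ('a \<Rightarrow> 'a \<Rightarrow> real) \<Rightarrow> ('a \<Rightarrow> real) set" where
  "columns_on I M = (\<lambda>v u. if u \<in> I then M u v else 0) ` I"

text \<open>
  The library constant \<open>dim\<close> is 0 on infinite-dimensional spaces, hence the case distinction.
\<close>

definition rank_on :: "'a set \<Rightarrow> ('a \<Rightarrow> 'a \<Rightarrow> real) \<Rightarrow> enat" where
  "rank_on I M =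
    (if \<exists>B. finite B \<and> span B = span (columns_on I M)
     then enat (dim (span (columns_on I M))) else \<infinity>)"

definition symmetric_on :: "'a set \<Rightarrow> ('a \<Rightarrow> 'a \<Rightarrow> real) \<Rightarrow> bool" where
  "symmetric_on I M \<longleftrightarrow> (\<forall>u\<in>I. \<forall>v\<in>I. M u v = M v u)"

text \<open>Only meaningful for finite \<open>I\<close>.\<close>

definition psd_on :: "'a set \<Rightarrow> ('a \<Rightarrow> 'a \<Rightarrow> real) \<Rightarrow> bool" where
  "psd_on I M \<longleftrightarrow> symmetric_on I M \<and>
     (\<forall>x :: 'a \<Rightarrow> real. 0 \<le> (\<Sum>u\<in>I. \<Sum>v\<in>I. x u * M u v * x v))"

text \<open>
  \<open>A\<close> is the upper left block of \<open>A'\<close>; the blocks \<open>B\<close> and \<open>C\<close> are the entries of \<open>A'\<close> involving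
  indices in \<open>J - I\<close>.
\<close>

definition flat_extension ::
  "'a set \<Rightarrow> ('a \<Rightarrow> 'a \<Rightarrow> real) \<Rightarrow> 'a set \<Rightarrow> ('a \<Rightarrow> 'a \<Rightarrow> real) \<Rightarrow> bool" where
  "flat_extension I A J A' \<longleftrightarrow>
     I \<subseteq> J \<and> symmetric_on I A \<and> symmetric_on J A' \<and>
     (\<forall>u\<in>I. \<forall>v\<in>I. A' u v = A u v) \<and> rank_on I A = rank_on J A'"

text \<open>
  Words in the letters \<open>X\<^sub>1, \<dots>, X\<^sub>n\<close> are lists over a finite type \<open>'n\<close> of letters; \<open>w\<^sup>*\<close> is \<open>rev w\<close>.
\<close>

definition cyc_equiv :: "'n list \<Rightarrow> 'n list \<Rightarrow> bool" where
  "cyc_equiv w u \<longleftrightarrow> (\<exists>k. u = rotate k w)"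

definition tracial_sequence :: "('n list \<Rightarrow> real) \<Rightarrow> bool" where
  "tracial_sequence y \<longleftrightarrow>
     (\<forall>w u. cyc_equiv w u \<longrightarrow> y w = y u) \<and> (\<forall>w. y w = y (rev w)) \<and> y [] = 1"

definition moment_matrix :: "('n list \<Rightarrow> real) \<Rightarrow> 'n list \<Rightarrow> 'n list \<Rightarrow> real" where
  "moment_matrix y u v = y (rev u @ v)"

definition words_upto :: "nat \<Rightarrow> 'n list set" where
  "words_upto k = {w. length w \<le> k}"

definition word_eval :: "nat \<Rightarrow> ('n \<Rightarrow> real mat) \<Rightarrow> 'n list \<Rightarrow> real mat" where
  "word_eval s A w = foldr (\<lambda>j M. A j * M) w (1\<^sub>m s)"

definition normalized_trace :: "real mat \<Rightarrow> real" where
  "normalized_trace A = (\<Sum>i<dim_row A. A $$ (i, i)) / real (dim_row A)"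

definition symmetric_tuple :: "nat \<Rightarrow> ('n \<Rightarrow> real mat) \<Rightarrow> bool" where
  "symmetric_tuple s A \<longleftrightarrow>
     (\<forall>j. A j \<in> carrier_mat s s \<and> transpose_mat (A j) = A j)"

text \<open>The size bound \<open>t\<close> is an extended natural number because it will be the rank of an infinite matrix.\<close>

definition tracial_moment_representation :: "enat \<Rightarrow> ('n list \<Rightarrow> real) \<Rightarrow> bool" where
  "tracial_moment_representation t y \<longleftrightarrow>
     (\<exists>(m :: nat) (s :: nat \<Rightarrow> nat) (A :: nat \<Rightarrow> 'n \<Rightarrow> real mat) (l :: nat \<Rightarrow> real).
        (\<forall>i<m. 1 \<le> s i \<and> enat (s i) \<le> t \<and> symmetric_tuple (s i) (A i) \<and> 0 \<le> l i) \<and>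
        (\<Sum>i<m. l i) = 1 \<and>
        (\<forall>w. y w = (\<Sum>i<m. l i * normalized_trace (word_eval (s i) (A i) w))))"

end

theory Submission
  imports Defs "Jordan_Normal_Form.Char_Poly"
begin

text \<open>
  The columns of the moment matrix span a space of dimension \<open>t\<close>, on which \<open>M(y)\<close> defines an inner
  product; by the rank condition the columns of \<open>M_N(y)\<close> already determine it, so positivity of
  \<open>M_N(y)\<close> suffices.  Words act on this space by symmetric left and right multiplications which
  commute, and \<open>y w = \<langle>e, w e\<rangle>\<close> for the column \<open>e\<close> of the empty word.  Split the space orthogonally into
  irreducible bimodules \<open>W\<close>, each generated by the component \<open>e\<close> of the original vector.  The trace of the
  left multiplications on \<open>W\<close> has the form \<open>tr w = \<langle>e, w z\<rangle>\<close>; traciality makes \<open>z\<close> central, hence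
  multiplication by \<open>z\<close> is a symmetric bimodule map and therefore a scalar \<open>\<mu> > 0\<close>.  So
  \<open>\<langle>e, w e\<rangle> = tr w / \<mu>\<close>, with matrices of size \<open>dim W \<le> t\<close>.  No structure theory of
  finite-dimensional algebras is needed, because the left regular representation is small enough.
\<close>

section \<open>Symmetric operators with respect to an inner product on a subspace\<close>

text \<open>All laws are relative to the carrier \<open>V\<close>, because the form used later is
  built from chosen coefficients that are meaningful only on its carrier. The spanning set in
  \<open>dim_bound\<close> records finite dimension, which a bound on \<open>dim\<close> alone would
  not do.\<close>

locale inner_product_on =
  fixes V :: "'v::real_vector set" and B :: "'v \<Rightarrow> 'v \<Rightarrow> real" and d :: nat
  assumes subspace_V: "subspace V"
    and sym: "x \<in> V \<Longrightarrow> y \<in> V \<Longrightarrow> B x y = B y x"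
    and add_right: "x \<in> V \<Longrightarrow> y \<in> V \<Longrightarrow> z \<in> V \<Longrightarrow> B x (y + z) = B x y + B x z"
    and scale_right: "x \<in> V \<Longrightarrow> y \<in> V \<Longrightarrow> B x (c *\<^sub>R y) = c * B x y"
    and pos: "x \<in> V \<Longrightarrow> x \<noteq> 0 \<Longrightarrow> 0 < B x x"
    and dim_bound: "\<exists>X. finite X \<and> card X \<le> d \<and> V \<subseteq> span X"
begin

lemma zero_right [simp]: "x \<in> V \<Longrightarrow> B x 0 = 0"
  using scale_right[of x x 0] by simp

lemma add_left: "x \<in> V \<Longrightarrow> y \<in> V \<Longrightarrow> z \<in> V \<Longrightarrow> B (x + y) z = B x z + B y z"
  using add_right[of z x y] sym subspace_add[OF subspace_V] by metis

lemma scale_left: "x \<in> V \<Longrightarrow> y \<in> V \<Longrightarrow> B (c *\<^sub>R x) y = c * B x y"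
  using scale_right[of y x c] sym subspace_scale[OF subspace_V] by metis

lemma diff_right: "x \<in> V \<Longrightarrow> y \<in> V \<Longrightarrow> z \<in> V \<Longrightarrow> B x (y - z) = B x y - B x z"
  using add_right[of x y "(-1) *\<^sub>R z"] scale_right[of x z "-1"] subspace_scale[OF subspace_V, of z "-1"]
  by simp

lemma sum_right:
  "x \<in> V \<Longrightarrow> (\<And>i. i \<in> I \<Longrightarrow> f i \<in> V) \<Longrightarrow> B x (sum f I) = (\<Sum>i\<in>I. B x (f i))"
proof (induction I rule: infinite_finite_induct)
  case (insert i I)
  then have "sum f I \<in> V"
    by (intro subspace_sum[OF subspace_V]) auto
  with insert show ?case
    by (simp add: add_right)
qed auto

lemma sum_left:
  assumes "x \<in> V" "\<And>i. i \<in> I \<Longrightarrow> f i \<in> V"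
  shows "B (sum f I) x = (\<Sum>i\<in>I. B (f i) x)"
proof -
  have "sum f I \<in> V"
    using assms by (intro subspace_sum[OF subspace_V]) auto
  then have "B (sum f I) x = B x (sum f I)"
    using assms sym by simp
  also have "\<dots> = (\<Sum>i\<in>I. B x (f i))"
    using assms by (intro sum_right)
  also have "\<dots> = (\<Sum>i\<in>I. B (f i) x)"
    using assms by (intro sum.cong) (auto simp: sym)
  finally show ?thesis .
qed

lemma nonneg: "x \<in> V \<Longrightarrow> 0 \<le> B x x"
  using pos[of x] by (cases "x = 0") auto

lemma eq_0_iff: "x \<in> V \<Longrightarrow> B x x = 0 \<longleftrightarrow> x = 0"
  using pos[of x] by fastforce

section \<open>Orthonormal systems and bases of subspaces\<close>

definition orthonormal :: "nat \<Rightarrow> (nat \<Rightarrow> 'v) \<Rightarrow> bool" where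
  "orthonormal s b \<longleftrightarrow> (\<forall>i<s. b i \<in> V) \<and> (\<forall>i<s. \<forall>k<s. B (b i) (b k) = (if i = k then 1 else 0))"

definition proj :: "nat \<Rightarrow> (nat \<Rightarrow> 'v) \<Rightarrow> 'v \<Rightarrow> 'v" where
  "proj s b x = (\<Sum>i<s. B (b i) x *\<^sub>R b i)"

definition onb :: "'v set \<Rightarrow> nat \<Rightarrow> (nat \<Rightarrow> 'v) \<Rightarrow> bool" where
  "onb W s b \<longleftrightarrow> orthonormal s b \<and> (\<forall>i<s. b i \<in> W) \<and> (\<forall>x\<in>W. proj s b x = x)"

lemma orthonormal_coeff:
  assumes "orthonormal s b" "i < s"
  shows "B (b i) (\<Sum>k<s. c k *\<^sub>R b k) = c i"
proof -
  have "B (b i) (\<Sum>k<s. c k *\<^sub>R b k) = (\<Sum>k<s. B (b i) (c k *\<^sub>R b k))"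
    using assms by (intro sum_right) (auto simp: orthonormal_def intro!: subspace_scale[OF subspace_V])
  also have "\<dots> = (\<Sum>k<s. if i = k then c k else 0)"
    using assms by (intro sum.cong) (auto simp: orthonormal_def scale_right)
  also have "\<dots> = c i"
    using assms(2) by simp
  finally show ?thesis .
qed

text \<open>Pairing a linear combination with one \<open>b i\<close> isolates its coefficient, so
  the family is injective and independent.\<close>

lemma orthonormal_le_card:
  assumes "orthonormal s b" "\<And>i. i < s \<Longrightarrow> b i \<in> span X" "finite X"
  shows "s \<le> card X"
proof -
  have inj: "inj_on b {..<s}"
  proof (rule inj_onI)
    fix i k assume "i \<in> {..<s}" "k \<in> {..<s}" "b i = b k"
    then show "i = k"
      using assms(1) unfolding orthonormal_def by (metis lessThan_iff zero_neq_one)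
  qed
  have "independent (b ` {..<s})"
    unfolding independent_explicit_finite_subsets
  proof (intro allI ballI impI)
    fix A u v assume A: "A \<subseteq> b ` {..<s}" "finite A" "(\<Sum>v\<in>A. u v *\<^sub>R v) = 0" "v \<in> A"
    then obtain i where i: "i < s" "v = b i"
      by auto
    have AV: "\<And>x. x \<in> A \<Longrightarrow> x \<in> V"
      using A(1) assms(1) by (auto simp: orthonormal_def)
    have "0 = B v (\<Sum>x\<in>A. u x *\<^sub>R x)"
      using A AV by simp
    also have "\<dots> = (\<Sum>x\<in>A. u x * B v x)"
      using AV A(4) by (simp add: sum_right subspace_scale[OF subspace_V] scale_right)
    also have "\<dots> = (\<Sum>x\<in>A. if v = x then u x else 0)"
    proof (rule sum.cong)
      fix x assume "x \<in> A"
      then obtain k where "k < s" "x = b k" using A(1) by auto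
      then show "u x * B v x = (if v = x then u x else 0)"
        using i inj_onD[OF inj, of i k] assms(1) by (auto simp: orthonormal_def)
    qed simp
    also have "\<dots> = u v"
      using A by simp
    finally show "u v = 0" by simp
  qed
  then have "card (b ` {..<s}) \<le> card X"
    using independent_span_bound[OF assms(3)] assms(2) by blast
  then show ?thesis
    using inj by (simp add: card_image)
qed

lemma proj_in: "subspace W \<Longrightarrow> (\<And>i. i < s \<Longrightarrow> b i \<in> W) \<Longrightarrow> proj s b x \<in> W"
  unfolding proj_def by (intro subspace_sum subspace_scale) auto

lemma proj_residual_orthogonal:
  assumes "orthonormal s b" "x \<in> V" "i < s"
  shows "B (b i) (x - proj s b x) = 0"
proof -
  have "proj s b x \<in> V"
    using assms by (intro proj_in subspace_V) (auto simp: orthonormal_def)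
  then show ?thesis
    using assms orthonormal_coeff[OF assms(1,3), of "\<lambda>k. B (b k) x"]
    by (simp add: diff_right orthonormal_def proj_def)
qed

text \<open>One Gram-Schmidt step: the normalized residual of \<open>x\<close> is appended at index
  \<open>s\<close>.\<close>

lemma orthonormal_extend:
  assumes "orthonormal s b" "subspace W" "W \<subseteq> V" "\<forall>i<s. b i \<in> W" "x \<in> W" "proj s b x \<noteq> x"
  shows "\<exists>b'. orthonormal (Suc s) b' \<and> (\<forall>i<Suc s. b' i \<in> W)"
proof -
  define r where "r = x - proj s b x"
  have r: "r \<in> W" "r \<noteq> 0"
    using assms proj_in[of W s b x] by (auto simp: r_def subspace_diff)
  then have rV: "r \<in> V" using assms by auto
  have orth: "B (b i) r = 0" if "i < s" for i
    using proj_residual_orthogonal[OF assms(1) _ that] assms by (auto simp: r_def)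
  have rr: "0 < B r r" using pos r rV by auto
  define n where "n = (1 / sqrt (B r r)) *\<^sub>R r"
  have nV: "n \<in> V" and nW: "n \<in> W"
    using r rV assms(2) subspace_V by (auto simp: n_def subspace_scale)
  have nn: "B n n = 1"
    using rr rV subspace_scale[OF subspace_V rV] by (simp add: n_def scale_left scale_right)
  have no: "B (b i) n = 0" "B n (b i) = 0" if "i < s" for i
  proof -
    have bi: "b i \<in> V" using assms(1) that by (auto simp: orthonormal_def)
    show "B (b i) n = 0" using orth[OF that] bi rV by (simp add: n_def scale_right)
    then show "B n (b i) = 0" using sym[OF bi nV] by simp
  qed
  have "orthonormal (Suc s) (b(s := n))"
    using assms(1) nV nn no by (auto simp: orthonormal_def less_Suc_eq)
  moreover have "\<forall>i<Suc s. (b(s := n)) i \<in> W"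
    using assms(4) nW by (auto simp: less_Suc_eq)
  ultimately show ?thesis by blast
qed

lemma orthonormal_le_bound: "orthonormal s b \<Longrightarrow> s \<le> d"
proof -
  assume "orthonormal s b"
  moreover obtain X where "finite X" "card X \<le> d" "V \<subseteq> span X" using dim_bound by auto
  ultimately show "s \<le> d"
    using orthonormal_le_card[of s b X] unfolding orthonormal_def by (meson order_trans subsetD)
qed

text \<open>A longest orthonormal system in \<open>W\<close> exists since lengths are at most
  \<open>d\<close>; any \<open>x\<close> that it fails to reproduce would extend it.\<close>

lemma onb_exists:
  assumes "subspace W" "W \<subseteq> V"
  shows "\<exists>s b. onb W s b"
proof -
  define P where "P s \<longleftrightarrow> (\<exists>b. orthonormal s b \<and> (\<forall>i<s. b i \<in> W))" for s
  have P0: "P 0" by (simp add: P_def orthonormal_def)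
  have bound: "s \<le> d" if "P s" for s using orthonormal_le_bound that by (auto simp: P_def)
  define s where "s = Greatest P"
  have s: "P s" using GreatestI_nat[of P 0 d] P0 bound by (simp add: s_def)
  have maximal: "s' \<le> s" if "P s'" for s'
    using Greatest_le_nat[of P s' d] that bound by (simp add: s_def)
  from s obtain b where b: "orthonormal s b" "\<forall>i<s. b i \<in> W" unfolding P_def by blast
  have "proj s b x = x" if "x \<in> W" for x
    using orthonormal_extend[OF b(1) assms b(2) that] maximal[of "Suc s"]
    unfolding P_def by fastforce
  then show ?thesis using b by (auto simp: onb_def)
qed

text \<open>Provides the decreasing measure for the induction over bimodules: a vector of
  \<open>W\<close> outside \<open>U\<close> allows \<open>c\<close> to be extended to
  \<open>r + 1\<close> orthonormal vectors in the span of \<open>s\<close> vectors.\<close>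

lemma onb_proper_less:
  assumes "onb W s b" "subspace W" "W \<subseteq> V" "onb U r c" "U \<subset> W" "subspace U"
  shows "r < s"
proof -
  obtain x where x: "x \<in> W" "x \<notin> U" using assms by auto
  have "proj r c x \<in> U" using assms by (intro proj_in) (auto simp: onb_def)
  then have "proj r c x \<noteq> x" using x by auto
  then obtain c' where c': "orthonormal (Suc r) c'" "\<forall>i<Suc r. c' i \<in> W"
    using orthonormal_extend[of r c W x] assms(2-5) x(1) unfolding onb_def by blast
  have "W \<subseteq> span (b ` {..<s})"
  proof
    fix x assume "x \<in> W"
    then have "x = (\<Sum>i<s. B (b i) x *\<^sub>R b i)" using assms(1) by (auto simp: onb_def proj_def)
    also have "\<dots> \<in> span (b ` {..<s})" by (intro span_sum span_scale span_base) auto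
    finally show "x \<in> span (b ` {..<s})" .
  qed
  then have "Suc r \<le> card (b ` {..<s})"
    using orthonormal_le_card[OF c'(1), of "b ` {..<s}"] c'(2) by auto
  also have "\<dots> \<le> s" using card_image_le[of "{..<s}" b] by simp
  finally show ?thesis by simp
qed

lemma onb_expand: "onb W s b \<Longrightarrow> x \<in> W \<Longrightarrow> x = (\<Sum>i<s. B (b i) x *\<^sub>R b i)"
  by (simp add: onb_def proj_def)

lemma parseval:
  assumes "onb W s b" "W \<subseteq> V" "x \<in> V" "y \<in> W"
  shows "B x y = (\<Sum>i<s. B x (b i) * B (b i) y)"
proof -
  have b: "\<And>i. i < s \<Longrightarrow> b i \<in> V" using assms by (auto simp: onb_def)
  have "B x y = B x (\<Sum>i<s. B (b i) y *\<^sub>R b i)"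
    using onb_expand[OF assms(1,4)] by simp
  also have "\<dots> = (\<Sum>i<s. B x (b i) * B (b i) y)"
    using b assms(3)
    by (subst sum_right) (auto simp: subspace_scale[OF subspace_V] scale_right mult.commute)
  finally show ?thesis .
qed

text \<open>The matrix of \<open>Z\<close> has a complex eigenvector. Symmetry makes its eigenvalue
  real, and then the real and imaginary parts of the eigenvector solve the same equation over the
  reals.\<close>

lemma symmetric_operator_eigenvector:
  assumes b: "onb W s b" and W: "W \<subseteq> V" "subspace W" and s: "0 < s"
    and ZW: "\<And>x. x \<in> W \<Longrightarrow> Z x \<in> W"
    and Zadd: "\<And>x y. Z (x + y) = Z x + Z y" and Zscale: "\<And>c x. Z (c *\<^sub>R x) = c *\<^sub>R Z x"
    and Zsym: "\<And>x y. x \<in> W \<Longrightarrow> y \<in> W \<Longrightarrow> B (Z x) y = B x (Z y)"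
  shows "\<exists>\<mu> x. x \<in> W \<and> x \<noteq> 0 \<and> Z x = \<mu> *\<^sub>R x"
proof -
  define C where "C = mat s s (\<lambda>(i, k). complex_of_real (B (b i) (Z (b k))))"
  have C: "C \<in> carrier_mat s s" by (simp add: C_def)
  have "degree (char_poly C) = s" using degree_monic_char_poly[OF C] by simp
  then have "\<not> constant (poly (char_poly C))" using s by (simp add: constant_degree)
  then obtain \<kappa> where "poly (char_poly C) \<kappa> = 0" using fundamental_theorem_of_algebra by blast
  then obtain v where v: "v \<in> carrier_vec s" "v \<noteq> 0\<^sub>v s" "C *\<^sub>v v = \<kappa> \<cdot>\<^sub>v v"
    using eigenvalue_root_char_poly[OF C] C by (auto simp: eigenvalue_def eigenvector_def)
  have vi: "(\<Sum>k<s. complex_of_real (B (b i) (Z (b k))) * v $ k) = \<kappa> * v $ i" if i: "i < s" for i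
  proof -
    have "(C *\<^sub>v v) $ i = (\<Sum>k<s. complex_of_real (B (b i) (Z (b k))) * v $ k)"
      using i v(1) by (auto simp: C_def scalar_prod_def atLeast0LessThan)
    then show ?thesis using v i by auto
  qed
  define comb where "comb c = (\<Sum>k<s. c k *\<^sub>R b k)" for c
  have bW: "\<And>i. i < s \<Longrightarrow> b i \<in> W" and onb: "orthonormal s b" using b by (auto simp: onb_def)
  have combW: "comb c \<in> W" for c
    unfolding comb_def using bW W by (intro subspace_sum subspace_scale) auto
  have Z0: "Z 0 = 0" using Zscale[of 0 0] by simp
  have Zsum: "Z (\<Sum>k\<in>I. f k) = (\<Sum>k\<in>I. Z (f k))" for f :: "nat \<Rightarrow> 'v" and I
    by (induction I rule: infinite_finite_induct) (auto simp: Zadd Z0)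
  have Zcomb: "Z (comb c) = comb (\<lambda>i. \<Sum>k<s. B (b i) (Z (b k)) * c k)" for c
  proof -
    have "Z (comb c) = (\<Sum>k<s. c k *\<^sub>R Z (b k))" by (simp add: comb_def Zsum Zscale)
    also have "\<dots> = (\<Sum>k<s. c k *\<^sub>R (\<Sum>i<s. B (b i) (Z (b k)) *\<^sub>R b i))"
      using onb_expand[OF b] ZW bW by (intro sum.cong) auto
    also have "\<dots> = (\<Sum>k<s. \<Sum>i<s. (B (b i) (Z (b k)) * c k) *\<^sub>R b i)"
      by (simp add: scaleR_sum_right mult.commute)
    also have "\<dots> = comb (\<lambda>i. \<Sum>k<s. B (b i) (Z (b k)) * c k)"
      unfolding comb_def by (subst sum.swap) (simp add: scaleR_sum_left)
    finally show ?thesis .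
  qed
  \<comment> \<open>\<open>Z\<close> acts on the pair formed by the real and imaginary parts of
    \<open>v\<close> as multiplication by \<open>\<kappa>\<close> acts on a complex number.\<close>
  define x where "x = comb (\<lambda>k. Re (v $ k))"
  define x' where "x' = comb (\<lambda>k. Im (v $ k))"
  have xW: "x \<in> W" "x' \<in> W" by (auto simp: x_def x'_def combW)
  then have xV: "x \<in> V" "x' \<in> V" using W by auto
  have Zx: "Z x = Re \<kappa> *\<^sub>R x - Im \<kappa> *\<^sub>R x'"
  proof -
    have "(\<Sum>k<s. B (b i) (Z (b k)) * Re (v $ k)) = Re \<kappa> * Re (v $ i) - Im \<kappa> * Im (v $ i)" if "i < s" for i
      using arg_cong[OF vi[OF that], of Re] by simp
    then have "Z x = (\<Sum>i<s. (Re \<kappa> * Re (v $ i) - Im \<kappa> * Im (v $ i)) *\<^sub>R b i)"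
      unfolding x_def Zcomb by (simp add: comb_def)
    then show ?thesis
      by (simp add: x_def x'_def comb_def scaleR_sum_right sum_subtractf scaleR_diff_left)
  qed
  have Zx': "Z x' = Im \<kappa> *\<^sub>R x + Re \<kappa> *\<^sub>R x'"
  proof -
    have "(\<Sum>k<s. B (b i) (Z (b k)) * Im (v $ k)) = Im \<kappa> * Re (v $ i) + Re \<kappa> * Im (v $ i)" if "i < s" for i
      using arg_cong[OF vi[OF that], of Im] by (simp add: add.commute)
    then have "Z x' = (\<Sum>i<s. (Im \<kappa> * Re (v $ i) + Re \<kappa> * Im (v $ i)) *\<^sub>R b i)"
      unfolding x'_def Zcomb by (simp add: comb_def)
    then show ?thesis
      by (simp add: x_def x'_def comb_def scaleR_sum_right sum.distrib scaleR_add_left)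
  qed
  have nz: "x \<noteq> 0 \<or> x' \<noteq> 0"
  proof (rule ccontr)
    assume "\<not> ?thesis"
    then have z: "x = 0" "x' = 0" by auto
    have "v $ i = 0" if "i < s" for i
    proof -
      have "Re (v $ i) = B (b i) x" "Im (v $ i) = B (b i) x'"
        unfolding x_def x'_def comb_def using orthonormal_coeff[OF onb that] by auto
      then show ?thesis using z bW[OF that] W by (auto simp: complex_eq_iff)
    qed
    then show False using v(1,2) by auto
  qed
  note sc = subspace_scale[OF subspace_V]
  \<comment> \<open>By symmetry \<open>B (Z x) x'\<close> and \<open>B x (Z x')\<close> agree, and
    comparing their expansions leaves only the terms in \<open>Im \<kappa>\<close>.\<close>
  have "B x' (Z x) = Re \<kappa> * B x' x - Im \<kappa> * B x' x'"
    using xV sc by (simp add: Zx diff_right scale_right)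
  moreover have "B x' x = B x x'" "B x' (Z x) = B (Z x) x'"
    using sym xV ZW[OF xW(1)] W by auto
  moreover have "B x (Z x') = Im \<kappa> * B x x + Re \<kappa> * B x x'"
    using xV sc by (simp add: Zx' add_right scale_right)
  ultimately have "Im \<kappa> * (B x x + B x' x') = 0"
    using Zsym[OF xW] by (simp add: algebra_simps)
  moreover have "0 < B x x + B x' x'"
    using nz nonneg[of x] nonneg[of x'] pos[of x] pos[of x'] xV by (cases "x = 0") auto
  ultimately have "Im \<kappa> = 0" by simp
  then have "Z x = Re \<kappa> *\<^sub>R x" "Z x' = Re \<kappa> *\<^sub>R x'" using Zx Zx' by auto
  then show ?thesis using nz xW by blast
qed

end

section \<open>Weighted sums of normalized traces\<close>

text \<open>In contrast to \<open>tracial_moment_representation\<close> the weights carry no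
  normalization, which makes the notion closed under addition; the empty word fixes their sum at the
  end.\<close>

definition trace_combination :: "nat \<Rightarrow> ('n list \<Rightarrow> real) \<Rightarrow> bool" where
  "trace_combination t f \<longleftrightarrow>
     (\<exists>(m :: nat) (s :: nat \<Rightarrow> nat) (A :: nat \<Rightarrow> 'n \<Rightarrow> real mat) (l :: nat \<Rightarrow> real).
        (\<forall>i<m. 1 \<le> s i \<and> s i \<le> t \<and> symmetric_tuple (s i) (A i) \<and> 0 \<le> l i) \<and>
        (\<forall>w. f w = (\<Sum>i<m. l i * normalized_trace (word_eval (s i) (A i) w))))"

lemma trace_combination_zero: "trace_combination t (\<lambda>w. 0)"
  unfolding trace_combination_def by (rule exI[of _ 0]) simp

lemma trace_combination_single:
  assumes "1 \<le> s" "s \<le> t" "symmetric_tuple s A" "0 \<le> c"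
    "\<And>w. f w = c * normalized_trace (word_eval s A w)"
  shows "trace_combination t f"
  unfolding trace_combination_def
  using assms
  by (intro exI[of _ 1] exI[of _ "\<lambda>_. s"] exI[of _ "\<lambda>_. A"] exI[of _ "\<lambda>_. c"]) auto

lemma trace_combination_add:
  assumes "trace_combination t f" "trace_combination t g"
  shows "trace_combination t (\<lambda>w. f w + g w)"
proof -
  obtain m :: nat and s A l where f:
    "\<forall>i<m. 1 \<le> s i \<and> s i \<le> t \<and> symmetric_tuple (s i) (A i) \<and> 0 \<le> l i"
    "\<forall>w. f w = (\<Sum>i<m. l i * normalized_trace (word_eval (s i) (A i) w))"
    using assms(1) unfolding trace_combination_def by blast
  obtain m' :: nat and s' A' l' where g:
    "\<forall>i<m'. 1 \<le> s' i \<and> s' i \<le> t \<and> symmetric_tuple (s' i) (A' i) \<and> 0 \<le> l' i"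
    "\<forall>w. g w = (\<Sum>i<m'. l' i * normalized_trace (word_eval (s' i) (A' i) w))"
    using assms(2) unfolding trace_combination_def by blast
  let ?join = "\<lambda>f g i. if i < m then f i else g (i - m)"
  have "(\<Sum>i<m + m'. h i) = (\<Sum>i<m. h i) + (\<Sum>i<m'. h (m + i))" for h :: "nat \<Rightarrow> real"
    by (induction m') simp_all
  then have "f w + g w = (\<Sum>i<m + m'. ?join l l' i *
      normalized_trace (word_eval (?join s s' i) (if i < m then A i else A' (i - m)) w))" for w
    using f(2) g(2) by simp
  moreover have "1 \<le> ?join s s' i \<and> ?join s s' i \<le> t \<and>
      symmetric_tuple (?join s s' i) (if i < m then A i else A' (i - m)) \<and> 0 \<le> ?join l l' i"
    if "i < m + m'" for i
    using f(1) g(1) that by auto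
  ultimately show ?thesis
    unfolding trace_combination_def
    by (intro exI[of _ "m + m'"] exI[of _ "?join s s'"] exI[of _ "\<lambda>i. if i < m then A i else A' (i - m)"]
        exI[of _ "?join l l'"]) blast
qed

section \<open>Cyclic bimodules over the words\<close>

text \<open>\<open>L\<close> and \<open>R\<close> model left and right multiplication by words, with
  reversal as adjoint. \<open>S\<close> is one set of words that has to serve every generator in
  \<open>cyclic\<close>.\<close>

locale bimodule = inner_product_on V B d
  for V :: "'v::real_vector set" and B d +
  fixes L R :: "'n list \<Rightarrow> 'v \<Rightarrow> 'v" and S :: "'n list set"
  assumes L_in: "x \<in> V \<Longrightarrow> L w x \<in> V"
    and R_in: "x \<in> V \<Longrightarrow> R w x \<in> V"
    and linear_L: "linear (L w)"
    and linear_R: "linear (R w)"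
    and L_Nil [simp]: "L [] x = x"
    and L_append: "L (v @ w) x = L v (L w x)"
    and L_R: "L v (R w x) = R w (L v x)"
    and L_adjoint: "x \<in> V \<Longrightarrow> y \<in> V \<Longrightarrow> B (L w x) y = B x (L (rev w) y)"
    and R_adjoint: "x \<in> V \<Longrightarrow> y \<in> V \<Longrightarrow> B (R w x) y = B x (R (rev w) y)"
begin

definition invariant :: "'v set \<Rightarrow> bool" where
  "invariant W \<longleftrightarrow> subspace W \<and> W \<subseteq> V \<and> (\<forall>w. \<forall>x\<in>W. L w x \<in> W \<and> R w x \<in> W)"

text \<open>The condition \<open>L w e = R w e\<close> says that \<open>e\<close> behaves like the
  unit of an algebra in its regular bimodule. Polynomials in the letters appear as coefficient
  functions \<open>p\<close> on \<open>S\<close>.\<close>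

definition cyclic :: "'v set \<Rightarrow> 'v \<Rightarrow> bool" where
  "cyclic W e \<longleftrightarrow> invariant W \<and> e \<in> W \<and> (\<forall>w. L w e = R w e) \<and>
     (\<forall>x\<in>W. \<exists>p. x = (\<Sum>u\<in>S. p u *\<^sub>R L u e))"

definition trace_on :: "nat \<Rightarrow> (nat \<Rightarrow> 'v) \<Rightarrow> 'n list \<Rightarrow> real" where
  "trace_on s b w = (\<Sum>i<s. B (b i) (L w (b i)))"

text \<open>The factor \<open>v\<close> moves across as \<open>rev v\<close>, and Parseval applies
  to \<open>L w (b i)\<close>, which lies in \<open>W\<close> by invariance.\<close>

lemma trace_on_append:
  assumes b: "onb W s b" and W: "invariant W"
  shows "trace_on s b (v @ w) = (\<Sum>i<s. \<Sum>k<s. B (b i) (L v (b k)) * B (b k) (L w (b i)))"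
proof -
  have WV: "W \<subseteq> V" and bW: "\<And>i. i < s \<Longrightarrow> b i \<in> W" using b W by (auto simp: onb_def invariant_def)
  have LW: "\<And>w x. x \<in> W \<Longrightarrow> L w x \<in> W" using W by (auto simp: invariant_def)
  have "B (b i) (L (v @ w) (b i)) = (\<Sum>k<s. B (b i) (L v (b k)) * B (b k) (L w (b i)))" if i: "i < s" for i
  proof -
    have bi: "b i \<in> V" "L w (b i) \<in> V" using bW[OF i] LW WV by auto
    have "B (b i) (L (v @ w) (b i)) = B (L (rev v) (b i)) (L w (b i))"
      using L_adjoint[OF bi, of "rev v"] by (simp add: L_append)
    also have "\<dots> = (\<Sum>k<s. B (L (rev v) (b i)) (b k) * B (b k) (L w (b i)))"
      using bW[OF i] by (intro parseval[OF b WV]) (auto simp: LW L_in bi)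
    also have "\<dots> = (\<Sum>k<s. B (b i) (L v (b k)) * B (b k) (L w (b i)))"
      using bW WV bi by (intro sum.cong) (auto simp: L_adjoint subset_iff)
    finally show ?thesis .
  qed
  then show ?thesis by (simp add: trace_on_def)
qed

lemma trace_on_commute:
  assumes "onb W s b" "invariant W"
  shows "trace_on s b (v @ w) = trace_on s b (w @ v)"
  unfolding trace_on_append[OF assms] by (subst sum.swap) (simp add: mult.commute)

lemma trace_on_rev:
  assumes "onb W s b"
  shows "trace_on s b (rev w) = trace_on s b w"
proof -
  have "B (b i) (L (rev w) (b i)) = B (b i) (L w (b i))" if "i < s" for i
  proof -
    have "b i \<in> V" using assms that by (auto simp: onb_def orthonormal_def)
    then show ?thesis using L_adjoint[of "b i" "b i" w] sym L_in by simp
  qed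
  then show ?thesis by (simp add: trace_on_def)
qed

text \<open>Invariance of \<open>W\<close> makes passing to matrices in the basis \<open>b\<close>
  multiplicative, so the letters determine the matrices of all words.\<close>

lemma word_eval_operator_matrix:
  assumes b: "onb W s b" and W: "invariant W"
  shows "word_eval s (\<lambda>j. mat s s (\<lambda>(i, k). B (b i) (L [j] (b k)))) w =
    mat s s (\<lambda>(i, k). B (b i) (L w (b k)))"
proof (induction w)
  case Nil
  show ?case using b by (auto simp: word_eval_def onb_def orthonormal_def)
next
  case (Cons j w)
  have WV: "W \<subseteq> V" and bW: "\<And>i. i < s \<Longrightarrow> b i \<in> W" using b W by (auto simp: onb_def invariant_def)
  have LW: "\<And>w x. x \<in> W \<Longrightarrow> L w x \<in> W" using W by (auto simp: invariant_def)
  have "B (b i) (L (j # w) (b k)) = (\<Sum>l<s. B (b i) (L [j] (b l)) * B (b l) (L w (b k)))"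
    if i: "i < s" and k: "k < s" for i k
  proof -
    have bi: "b i \<in> V" "L w (b k) \<in> V" using bW[OF i] bW[OF k] LW WV by auto
    have "B (b i) (L (j # w) (b k)) = B (L [j] (b i)) (L w (b k))"
      using L_adjoint[OF bi, of "[j]"] L_append[of "[j]" w] by simp
    also have "\<dots> = (\<Sum>l<s. B (L [j] (b i)) (b l) * B (b l) (L w (b k)))"
      using bW[OF k] by (intro parseval[OF b WV]) (auto simp: LW L_in bi)
    also have "\<dots> = (\<Sum>l<s. B (b i) (L [j] (b l)) * B (b l) (L w (b k)))"
      using bW WV bi by (intro sum.cong) (auto simp: L_adjoint subset_iff)
    finally show ?thesis .
  qed
  then show ?case
    using Cons.IH by (auto simp: word_eval_def scalar_prod_def atLeast0LessThan)
qed

text \<open>One-letter words equal their reversal, hence their matrices are symmetric; the weight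
  \<open>c * real s\<close> undoes the normalization of the trace.\<close>

lemma trace_combination_trace_on:
  assumes b: "onb W s b" and W: "invariant W" and s: "0 < s" and c: "0 \<le> c"
  shows "trace_combination d (\<lambda>w. c * trace_on s b w)"
proof (rule trace_combination_single)
  show "s \<le> d" using b orthonormal_le_bound by (auto simp: onb_def)
  have bV: "\<And>i. i < s \<Longrightarrow> b i \<in> V" using b by (auto simp: onb_def orthonormal_def)
  have "B (b i) (L [j] (b k)) = B (b k) (L [j] (b i))" if "i < s" "k < s" for i j k
    using L_adjoint[of "b i" "b k" "[j]"] sym bV that L_in by simp
  then show "symmetric_tuple s (\<lambda>j. mat s s (\<lambda>(i, k). B (b i) (L [j] (b k))))"
    by (auto simp: symmetric_tuple_def)
  show "1 \<le> s" "0 \<le> c * real s" using s c by auto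
  show "c * trace_on s b w = c * real s * normalized_trace
      (word_eval s (\<lambda>j. mat s s (\<lambda>(i, k). B (b i) (L [j] (b k)))) w)" for w
    using s by (simp add: word_eval_operator_matrix[OF b W] normalized_trace_def trace_on_def)
qed

section \<open>Traces on cyclic and irreducible bimodules\<close>

lemma cyclic_operator_eqI:
  assumes "cyclic W e" "linear f" "linear g" "\<And>w. f (L w e) = g (L w e)" "x \<in> W"
  shows "f x = g x"
proof -
  obtain p where "x = (\<Sum>u\<in>S. p u *\<^sub>R L u e)" using assms(1,5) unfolding cyclic_def by blast
  then show ?thesis using assms(2-4) by (simp add: linear_sum linear_scale)
qed

text \<open>The vectors \<open>L w e\<close> span \<open>W\<close>, so \<open>x - y\<close> is
  orthogonal to itself.\<close>

lemma cyclic_eqI: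
  assumes W: "cyclic W e" and "x \<in> W" "y \<in> W" "\<And>w. B (L w e) x = B (L w e) y"
  shows "x = y"
proof -
  have inv: "invariant W" and e: "e \<in> W" and WV: "W \<subseteq> V" using W by (auto simp: cyclic_def invariant_def)
  have xy: "x - y \<in> W" using assms inv by (auto simp: invariant_def subspace_diff)
  then obtain p where p: "x - y = (\<Sum>u\<in>S. p u *\<^sub>R L u e)" using W unfolding cyclic_def by blast
  have LV: "\<And>u. L u e \<in> V" using L_in e WV by auto
  have "B (x - y) (x - y) = (\<Sum>u\<in>S. B (p u *\<^sub>R L u e) (x - y))"
    using LV xy WV by (subst (1) p, intro sum_left) (auto intro: subspace_scale[OF subspace_V])
  also have "\<dots> = (\<Sum>u\<in>S. p u * (B (L u e) x - B (L u e) y))"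
    using LV xy WV assms by (intro sum.cong) (auto simp: scale_left diff_right subset_iff)
  also have "\<dots> = 0" using assms by simp
  finally show ?thesis using xy WV eq_0_iff[of "x - y"] by auto
qed

text \<open>The first argument of \<open>B (b i) (L w (b i))\<close> is written through right
  multiplications of \<open>e\<close>; their adjoints commute with \<open>L w\<close> and are
  collected in the second argument.\<close>

lemma trace_on_representer:
  assumes W: "cyclic W e" and b: "onb W s b"
  shows "\<exists>z\<in>W. \<forall>w. trace_on s b w = B e (L w z)"
proof -
  have inv: "invariant W" and e: "e \<in> W" and LRe: "\<And>w. L w e = R w e" using W by (auto simp: cyclic_def)
  have sub: "subspace W" and WV: "W \<subseteq> V" and LW: "\<And>w x. x \<in> W \<Longrightarrow> L w x \<in> W"
    and RW: "\<And>w x. x \<in> W \<Longrightarrow> R w x \<in> W"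
    using inv by (auto simp: invariant_def)
  have bW: "\<And>i. i < s \<Longrightarrow> b i \<in> W" using b by (auto simp: onb_def)
  have "\<forall>i. \<exists>p. i < s \<longrightarrow> b i = (\<Sum>u\<in>S. p u *\<^sub>R L u e)"
    using W bW unfolding cyclic_def by blast
  then obtain p where p: "\<And>i. i < s \<Longrightarrow> b i = (\<Sum>u\<in>S. p i u *\<^sub>R L u e)" by metis
  txt \<open>Write \<open>b i = p i e\<close> with a polynomial \<open>p i\<close>; then \<open>z\<close> is \<open>\<Sum>i. p i (p i)\<^sup>*\<close> applied to \<open>e\<close>.\<close>
  define z where "z = (\<Sum>i<s. \<Sum>u\<in>S. p i u *\<^sub>R R (rev u) (b i))"
  have "z \<in> W"
    unfolding z_def using bW RW by (intro subspace_sum[OF sub] subspace_scale[OF sub]) auto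
  moreover have "trace_on s b w = B e (L w z)" for w
  proof -
    have "B (b i) (L w (b i)) = (\<Sum>u\<in>S. p i u * B e (L w (R (rev u) (b i))))" if i: "i < s" for i
    proof -
      have V: "L w (b i) \<in> V" "e \<in> V" "\<And>u. R u e \<in> V" using LW RW bW[OF i] e WV by auto
      have "B (b i) (L w (b i)) = B (\<Sum>u\<in>S. p i u *\<^sub>R R u e) (L w (b i))"
        using p[OF i] by (simp add: LRe)
      also have "\<dots> = (\<Sum>u\<in>S. p i u * B (R u e) (L w (b i)))"
        using V by (simp add: sum_left subspace_scale[OF subspace_V] scale_left)
      finally show ?thesis using V by (simp add: R_adjoint L_R)
    qed
    then have "trace_on s b w = (\<Sum>i<s. \<Sum>u\<in>S. p i u * B e (L w (R (rev u) (b i))))"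
      by (simp add: trace_on_def)
    also have "\<dots> = (\<Sum>i<s. \<Sum>u\<in>S. B e (p i u *\<^sub>R L w (R (rev u) (b i))))"
      using bW LW RW e WV by (intro sum.cong) (auto simp: scale_right subset_iff)
    also have "\<dots> = (\<Sum>i<s. B e (\<Sum>u\<in>S. p i u *\<^sub>R L w (R (rev u) (b i))))"
      using bW LW RW e WV
      by (intro sum.cong refl sum_right[symmetric]) (auto intro!: subspace_scale[OF subspace_V])
    also have "\<dots> = B e (\<Sum>i<s. \<Sum>u\<in>S. p i u *\<^sub>R L w (R (rev u) (b i)))"
      using bW LW RW e WV
      by (intro sum_right[symmetric]) (auto intro!: subspace_scale[OF subspace_V] subspace_sum[OF subspace_V])
    also have "\<dots> = B e (L w z)"
      by (simp add: z_def linear_sum[OF linear_L] linear_scale[OF linear_L])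
    finally show ?thesis .
  qed
  ultimately show ?thesis by blast
qed

text \<open>A form of Schur's lemma: the representer \<open>z\<close> of the trace yields a
  symmetric bimodule map on \<open>W\<close>, one of whose eigenspaces is a nonzero invariant
  subspace and hence all of \<open>W\<close>.\<close>

lemma cyclic_irreducible_trace:
  assumes W: "cyclic W e" and b: "onb W s b" and s: "0 < s"
    and irred: "\<And>U. invariant U \<Longrightarrow> U \<subseteq> W \<Longrightarrow> U \<noteq> {0} \<Longrightarrow> U = W"
  shows "\<exists>c\<ge>0. \<forall>w. B e (L w e) = c * trace_on s b w"
proof -
  have inv: "invariant W" and e: "e \<in> W" and LRe: "\<And>w. L w e = R w e" using W by (auto simp: cyclic_def)
  have sub: "subspace W" and WV: "W \<subseteq> V" and LW: "\<And>w x. x \<in> W \<Longrightarrow> L w x \<in> W"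
    and RW: "\<And>w x. x \<in> W \<Longrightarrow> R w x \<in> W"
    using inv by (auto simp: invariant_def)
  have eV: "e \<in> V" using e WV by auto
  obtain z where z: "z \<in> W" and tr: "\<And>w. trace_on s b w = B e (L w z)"
    using trace_on_representer[OF W b] by blast
  have zV: "z \<in> V" using z WV by auto
  \<comment> \<open>Through this identity properties of the trace become properties of
    \<open>z\<close>: \<open>trace_on_commute\<close> yields centrality, \<open>trace_on_rev\<close>
    yields symmetry of \<open>Z\<close>.\<close>
  have tr': "B (L v e) (L w z) = trace_on s b (rev v @ w)" for v w
    using zV eV by (simp add: L_adjoint L_in tr L_append)
  have central: "L w z = R w z" for w
  proof (rule cyclic_eqI[OF W])
    show "L w z \<in> W" "R w z \<in> W" using LW RW z by auto
    show "B (L v e) (L w z) = B (L v e) (R w z)" for v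
    proof -
      have "B (L v e) (R w z) = B (R (rev w) (L v e)) z"
        using zV eV by (simp add: R_adjoint L_in)
      also have "\<dots> = B (L (v @ rev w) e) (L [] z)"
        by (simp add: L_append LRe[of "rev w"] L_R)
      also have "\<dots> = trace_on s b (w @ rev v)"
        unfolding tr' by simp
      finally show ?thesis using tr' trace_on_commute[OF b inv] by simp
    qed
  qed
  obtain q where q: "z = (\<Sum>u\<in>S. q u *\<^sub>R L u e)" using W z unfolding cyclic_def by blast
  txt \<open>\<open>Z\<close> is left multiplication by the central element represented by \<open>z\<close>.\<close>
  define Z where "Z x = (\<Sum>u\<in>S. q u *\<^sub>R L u x)" for x
  have linear_Z: "linear Z"
    unfolding Z_def using linear_L
    by (intro linearI) (simp_all add: linear_add linear_scale scaleR_add_right sum.distrib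
      scaleR_sum_right mult.commute)
  have ZW: "Z x \<in> W" if "x \<in> W" for x
    unfolding Z_def using LW that by (intro subspace_sum[OF sub] subspace_scale[OF sub]) auto
  have Z_R: "Z (R w x) = R w (Z x)" for w x
    by (simp add: Z_def linear_sum[OF linear_R] linear_scale[OF linear_R] L_R)
  have Ze: "Z e = z" by (simp add: Z_def q)
  have ZLe: "Z (L w e) = L w z" for w
    by (simp add: LRe Z_R Ze central)
  \<comment> \<open>Other than \<open>Z_R\<close>, this relies on the generator: both sides are
    compared on the vectors \<open>L w e\<close>.\<close>
  have Z_L: "Z (L v x) = L v (Z x)" if "x \<in> W" for v x
  proof (rule cyclic_operator_eqI[OF W _ _ _ that])
    show "linear (\<lambda>x. Z (L v x))" "linear (\<lambda>x. L v (Z x))"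
      using linear_compose[OF linear_L[of v] linear_Z] linear_compose[OF linear_Z linear_L[of v]]
      by (simp_all add: o_def)
    show "Z (L v (L w e)) = L v (Z (L w e))" for w
      using ZLe[of "v @ w"] ZLe[of w] by (simp add: L_append)
  qed
  have Z_sym0: "B (Z (L v e)) (L w e) = B (L v e) (Z (L w e))" for v w
  proof -
    have "B (Z (L v e)) (L w e) = B (L w e) (L v z)"
      using zV eV by (simp add: ZLe sym L_in)
    also have "\<dots> = trace_on s b (rev w @ v)" by (rule tr')
    also have "\<dots> = trace_on s b (rev v @ w)" using trace_on_rev[OF b, of "rev v @ w"] by simp
    finally show ?thesis by (simp add: ZLe tr')
  qed
  have Z_sym: "B (Z x) y = B x (Z y)" if xW: "x \<in> W" and yW: "y \<in> W" for x y
  proof -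
    have LeV: "\<And>u. L u e \<in> V" "\<And>u. Z (L u e) \<in> V" using LW e WV ZW by auto
    obtain p r where x: "x = (\<Sum>u\<in>S. p u *\<^sub>R L u e)" and y: "y = (\<Sum>u\<in>S. r u *\<^sub>R L u e)"
      using W xW yW unfolding cyclic_def by metis
    note simps = sum_left sum_right scale_left scale_right subspace_scale[OF subspace_V]
      subspace_sum[OF subspace_V] linear_sum[OF linear_Z] linear_scale[OF linear_Z] LeV
    have "B (Z x) y = (\<Sum>u\<in>S. \<Sum>v\<in>S. p u * (r v * B (Z (L u e)) (L v e)))"
      unfolding x y
      by (simp add: simps sum_distrib_left, subst sum.swap, simp add: mult.left_commute)
    moreover have "B x (Z y) = (\<Sum>u\<in>S. \<Sum>v\<in>S. p u * (r v * B (L u e) (Z (L v e))))"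
      unfolding x y
      by (simp add: simps sum_distrib_left, subst sum.swap, simp add: mult.left_commute)
    ultimately show ?thesis by (simp add: Z_sym0)
  qed
  obtain \<mu> x where x: "x \<in> W" "x \<noteq> 0" "Z x = \<mu> *\<^sub>R x"
    using symmetric_operator_eigenvector[OF b WV sub s ZW _ _ Z_sym]
      linear_add[OF linear_Z] linear_scale[OF linear_Z] by blast
  let ?U = "{x \<in> W. Z x = \<mu> *\<^sub>R x}"
  have "subspace ?U"
    using sub linear_Z unfolding subspace_def
    by (auto simp: linear_add linear_scale linear_0 scaleR_add_right)
  then have "invariant ?U"
    using LW RW WV by (auto simp: invariant_def Z_L Z_R linear_scale[OF linear_L] linear_scale[OF linear_R])
  then have "?U = W" using irred[of ?U] x by auto
  then have ze: "z = \<mu> *\<^sub>R e" using e Ze by auto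
  have tr\<mu>: "trace_on s b w = \<mu> * B e (L w e)" for w
    using eV by (simp add: tr ze linear_scale[OF linear_L] scale_right L_in)
  \<comment> \<open>At the empty word the trace is the dimension, whose positivity forces
    \<open>\<mu> > 0\<close> and permits the division.\<close>
  have "trace_on s b [] = real s"
    using b by (simp add: trace_on_def onb_def orthonormal_def)
  then have "0 < \<mu> * B e e" using tr\<mu>[of "[]"] s by simp
  then have "0 < \<mu>" using nonneg[OF eV] by (simp add: zero_less_mult_iff)
  then show ?thesis using tr\<mu> by (intro exI[of _ "1 / \<mu>"]) auto
qed

text \<open>The components of \<open>e\<close> along \<open>U\<close> and its orthogonal complement
  are the new generators; identities for \<open>e\<close> split because \<open>U\<close> and
  \<open>U'\<close> meet only in 0.\<close>

lemma cyclic_split: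
  assumes W: "cyclic W e" and U: "invariant U" "U \<subseteq> W"
  defines "U' \<equiv> {x \<in> W. \<forall>u\<in>U. B u x = 0}"
  shows "\<exists>e1 e2. cyclic U e1 \<and> cyclic U' e2 \<and> (\<forall>w. B e (L w e) = B e1 (L w e1) + B e2 (L w e2))"
proof -
  have inv: "invariant W" and e: "e \<in> W" and LRe: "\<And>w. L w e = R w e" using W by (auto simp: cyclic_def)
  have sub: "subspace W" and WV: "W \<subseteq> V" and LW: "\<And>w x. x \<in> W \<Longrightarrow> L w x \<in> W"
    and RW: "\<And>w x. x \<in> W \<Longrightarrow> R w x \<in> W"
    using inv by (auto simp: invariant_def)
  have subU: "subspace U" and UV: "U \<subseteq> V" and LU: "\<And>w x. x \<in> U \<Longrightarrow> L w x \<in> U"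
    and RU: "\<And>w x. x \<in> U \<Longrightarrow> R w x \<in> U"
    using U by (auto simp: invariant_def)
  have subU': "subspace U'"
    using sub UV WV unfolding subspace_def U'_def
    by (auto simp: add_right scale_right subset_iff)
  have LU': "L w x \<in> U'" and RU': "R w x \<in> U'" if x: "x \<in> U'" for w x
  proof -
    have xV: "x \<in> V" "x \<in> W" using x WV by (auto simp: U'_def)
    have "B u (L w x) = 0" "B u (R w x) = 0" if u: "u \<in> U" for u
    proof -
      have uV: "u \<in> V" using u UV by auto
      show "B u (L w x) = 0"
        using L_adjoint[OF uV xV(1), of "rev w"] LU[OF u] x by (simp add: U'_def)
      show "B u (R w x) = 0"
        using R_adjoint[OF uV xV(1), of "rev w"] RU[OF u] x by (simp add: U'_def)
    qed
    then show "L w x \<in> U'" "R w x \<in> U'" using LW RW xV by (auto simp: U'_def)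
  qed
  have U'V: "U' \<subseteq> V" using WV by (auto simp: U'_def)
  have inv': "invariant U'" using subU' U'V LU' RU' by (auto simp: invariant_def)
  have disj: "x = 0" if "x \<in> U" "x \<in> U'" for x
    using that eq_0_iff[of x] UV by (auto simp: U'_def)
  obtain r c where c: "onb U r c" using onb_exists[OF subU UV] by auto
  have cU: "\<And>i. i < r \<Longrightarrow> c i \<in> U" and onc: "orthonormal r c" using c by (auto simp: onb_def)
  define e1 where "e1 = proj r c e"
  define e2 where "e2 = e - e1"
  have e1: "e1 \<in> U" unfolding e1_def using cU by (intro proj_in subU)
  have ee: "e = e1 + e2" by (simp add: e2_def)
  have e2W: "e2 \<in> W" using sub e e1 U by (auto simp: e2_def subspace_diff)
  have e2: "e2 \<in> U'"
  proof -
    have "B u e2 = 0" if u: "u \<in> U" for u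
    proof -
      have e2V: "e2 \<in> V" "u \<in> V" using e2W WV u UV by auto
      have "B u e2 = B e2 (\<Sum>i<r. B (c i) u *\<^sub>R c i)"
        using onb_expand[OF c u] sym e2V by simp
      also have "\<dots> = (\<Sum>i<r. B (c i) u * B e2 (c i))"
        using e2V cU UV by (subst sum_right) (auto simp: subspace_scale[OF subspace_V] scale_right subset_iff)
      also have "\<dots> = (\<Sum>i<r. B (c i) u * B (c i) e2)"
        using e2V cU UV by (intro sum.cong) (auto simp: sym subset_iff)
      also have "\<dots> = 0"
        using proj_residual_orthogonal[OF onc, of e] e WV by (auto simp: e2_def e1_def)
      finally show ?thesis .
    qed
    then show ?thesis using e2W by (simp add: U'_def)
  qed
  have LR12: "L w e1 = R w e1 \<and> L w e2 = R w e2" for w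
  proof -
    \<comment> \<open>The left side lies in \<open>U\<close> and the right side in
      \<open>U'\<close>, so both vanish.\<close>
    have "L w e1 - R w e1 = R w e2 - L w e2"
      using LRe[of w] unfolding ee
      by (simp add: linear_add[OF linear_L] linear_add[OF linear_R] algebra_simps)
    moreover have "L w e1 - R w e1 \<in> U" "R w e2 - L w e2 \<in> U'"
      using e1 e2 LU RU LU' RU' subU subU' by (auto intro: subspace_diff)
    ultimately have "L w e1 - R w e1 = 0" "R w e2 - L w e2 = 0" using disj by metis+
    then show ?thesis by simp
  qed
  have sumU: "(\<Sum>u\<in>S. p u *\<^sub>R L u e1) \<in> U" "(\<Sum>u\<in>S. p u *\<^sub>R L u e2) \<in> U'" for p
    using e1 e2 LU LU' subU subU' by (auto intro!: subspace_sum subspace_scale)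
  \<comment> \<open>The same \<open>p\<close> serves both components, so for \<open>x\<close> in one
    of the two spaces the sum in the other is 0.\<close>
  have split: "\<exists>p. x = (\<Sum>u\<in>S. p u *\<^sub>R L u e1) + (\<Sum>u\<in>S. p u *\<^sub>R L u e2)" if "x \<in> W" for x
  proof -
    obtain p where "x = (\<Sum>u\<in>S. p u *\<^sub>R L u e)" using W \<open>x \<in> W\<close> unfolding cyclic_def by blast
    then have "x = (\<Sum>u\<in>S. p u *\<^sub>R L u e1) + (\<Sum>u\<in>S. p u *\<^sub>R L u e2)"
      unfolding ee by (simp add: linear_add[OF linear_L] scaleR_add_right sum.distrib)
    then show ?thesis by blast
  qed
  have "\<exists>p. x = (\<Sum>u\<in>S. p u *\<^sub>R L u e1)" if x: "x \<in> U" for x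
  proof -
    obtain p where p: "x = (\<Sum>u\<in>S. p u *\<^sub>R L u e1) + (\<Sum>u\<in>S. p u *\<^sub>R L u e2)"
      using split x U by blast
    then have "x - (\<Sum>u\<in>S. p u *\<^sub>R L u e1) = (\<Sum>u\<in>S. p u *\<^sub>R L u e2)" by simp
    moreover have "x - (\<Sum>u\<in>S. p u *\<^sub>R L u e1) \<in> U" using x sumU subU by (intro subspace_diff)
    ultimately have "x - (\<Sum>u\<in>S. p u *\<^sub>R L u e1) = 0" using disj sumU by metis
    then show ?thesis by (intro exI[of _ p]) simp
  qed
  then have "cyclic U e1" using U e1 LR12 by (auto simp: cyclic_def)
  moreover have "\<exists>p. x = (\<Sum>u\<in>S. p u *\<^sub>R L u e2)" if x: "x \<in> U'" for x
  proof -
    obtain p where p: "x = (\<Sum>u\<in>S. p u *\<^sub>R L u e1) + (\<Sum>u\<in>S. p u *\<^sub>R L u e2)"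
      using split x by (auto simp: U'_def)
    then have "x - (\<Sum>u\<in>S. p u *\<^sub>R L u e2) = (\<Sum>u\<in>S. p u *\<^sub>R L u e1)" by simp
    moreover have "x - (\<Sum>u\<in>S. p u *\<^sub>R L u e2) \<in> U'" using x sumU subU' by (intro subspace_diff)
    ultimately have "x - (\<Sum>u\<in>S. p u *\<^sub>R L u e2) = 0" using disj sumU by metis
    then show ?thesis by (intro exI[of _ p]) simp
  qed
  then have "cyclic U' e2" using inv' e2 LR12 by (auto simp: cyclic_def)
  moreover have "B e (L w e) = B e1 (L w e1) + B e2 (L w e2)" for w
  proof -
    have V: "e1 \<in> V" "e2 \<in> V" "L w e1 \<in> V" "L w e2 \<in> V" using e1 e2 UV U'V L_in by auto
    have "B e1 (L w e2) = 0" using e1 LU'[OF e2] by (auto simp: U'_def)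
    moreover have "B (L w e1) e2 = 0" using LU[OF e1] e2 by (auto simp: U'_def)
    then have "B e2 (L w e1) = 0" using sym[OF V(2,3)] by simp
    ultimately show ?thesis
      unfolding ee using V
      by (simp add: linear_add[OF linear_L] add_left add_right subspace_add[OF subspace_V])
  qed
  ultimately show ?thesis by blast
qed

text \<open>Strong induction on the dimension \<open>s\<close>: a proper nonzero invariant
  \<open>U\<close> and its complement both have smaller dimension, and an irreducible
  \<open>W\<close> is settled by \<open>cyclic_irreducible_trace\<close>.\<close>

lemma cyclic_trace_combination:
  assumes "cyclic W e" "onb W s b"
  shows "trace_combination d (\<lambda>w. B e (L w e))"
  using assms
proof (induction s arbitrary: W e b rule: less_induct)
  case (less s)
  have inv: "invariant W" and e: "e \<in> W" using less.prems by (auto simp: cyclic_def)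
  then have sub: "subspace W" and WV: "W \<subseteq> V" by (auto simp: invariant_def)
  consider "s = 0" | U where "invariant U" "U \<subseteq> W" "U \<noteq> {0}" "U \<noteq> W"
    | "0 < s" "\<And>U. invariant U \<Longrightarrow> U \<subseteq> W \<Longrightarrow> U \<noteq> {0} \<Longrightarrow> U = W"
    by blast
  then show ?case
  proof cases
    case 1
    then have "e = 0" using onb_expand[OF less.prems(2) e] by simp
    then have "(\<lambda>w. B e (L w e)) = (\<lambda>w. 0)"
      using e WV linear_0[OF linear_L] by auto
    then show ?thesis by (simp add: trace_combination_zero)
  next
    case (2 U)
    let ?U' = "{x \<in> W. \<forall>u\<in>U. B u x = 0}"
    obtain e1 e2 where e12: "cyclic U e1" "cyclic ?U' e2"
      "\<And>w. B e (L w e) = B e1 (L w e1) + B e2 (L w e2)"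
      using cyclic_split[OF less.prems(1) 2(1,2)] by blast
    have U: "subspace U" "U \<subseteq> V" and U': "subspace ?U'" "?U' \<subseteq> V"
      using e12 by (auto simp: cyclic_def invariant_def)
    obtain s1 b1 where b1: "onb U s1 b1" using onb_exists[OF U] by auto
    obtain s2 b2 where b2: "onb ?U' s2 b2" using onb_exists[OF U'] by auto
    obtain u where u: "u \<in> U" "u \<noteq> 0" using 2(3) subspace_0[OF U(1)] by blast
    then have "u \<notin> ?U'" using pos[of u] U by fastforce
    then have "?U' \<subset> W" using u 2(2) by blast
    then have "s2 < s" using onb_proper_less[OF less.prems(2) sub WV b2 _ U'(1)] by simp
    moreover have "s1 < s" using onb_proper_less[OF less.prems(2) sub WV b1 _ U(1)] 2 by blast
    ultimately have "trace_combination d (\<lambda>w. B e1 (L w e1))" "trace_combination d (\<lambda>w. B e2 (L w e2))"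
      using less.IH e12 b1 b2 by blast+
    then show ?thesis using trace_combination_add e12(3) by simp
  next
    case 3
    then obtain c where "c \<ge> 0" "\<And>w. B e (L w e) = c * trace_on s b w"
      using cyclic_irreducible_trace[OF less.prems] by blast
    then show ?thesis using trace_combination_trace_on[OF less.prems(2) inv 3(1)] by simp
  qed
qed

end

section \<open>Finite spans and linear independence\<close>

lemma sum_fun_apply: "(\<Sum>i\<in>I. f i) x = (\<Sum>i\<in>I. f i x)"
  by (induction I rule: infinite_finite_induct) simp_all

text \<open>Coefficients are indexed by \<open>S\<close> rather than by the image, since
  \<open>g\<close> may repeat values, as happens with equal columns.\<close>

lemma in_span_image_iff:
  assumes "finite S"
  shows "x \<in> span (g ` S) \<longleftrightarrow> (\<exists>p. x = (\<Sum>u\<in>S. p u *\<^sub>R g u))"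
proof
  assume "x \<in> span (g ` S)"
  then show "\<exists>p. x = (\<Sum>u\<in>S. p u *\<^sub>R g u)"
  proof (induction rule: span_induct_alt)
    case base
    show ?case by (intro exI[of _ "\<lambda>_. 0"]) simp
  next
    case (step c x y)
    then obtain v p where v: "v \<in> S" "x = g v" "y = (\<Sum>u\<in>S. p u *\<^sub>R g u)" by auto
    then have "c *\<^sub>R x + y = (\<Sum>u\<in>S. (if u = v then c else 0) *\<^sub>R g u) + y"
      using assms by (simp add: if_distrib[of "\<lambda>a. a *\<^sub>R _"] cong: if_cong)
    also have "\<dots> = (\<Sum>u\<in>S. ((if u = v then c else 0) + p u) *\<^sub>R g u)"
      by (simp add: v scaleR_add_left sum.distrib)
    finally show ?case by (intro exI[of _ "\<lambda>u. (if u = v then c else 0) + p u"])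
  qed
next
  assume "\<exists>p. x = (\<Sum>u\<in>S. p u *\<^sub>R g u)"
  then obtain p where "x = (\<Sum>u\<in>S. p u *\<^sub>R g u)" ..
  then show "x \<in> span (g ` S)" by (auto intro: span_sum span_scale span_base)
qed

text \<open>Serves to lift independence from columns truncated to finitely many rows to the full
  columns.\<close>

lemma independent_of_image:
  assumes f: "linear f" and ind: "independent (f ` Y)" and inj: "inj_on f Y"
  shows "independent Y"
  unfolding independent_explicit_finite_subsets
proof (intro allI ballI impI)
  fix A u a assume A: "A \<subseteq> Y" "finite A" "(\<Sum>v\<in>A. u v *\<^sub>R v) = 0" "a \<in> A"
  have injA: "inj_on f A" using inj A(1) by (rule inj_on_subset)
  have "(\<Sum>x\<in>f ` A. u (inv_into A f x) *\<^sub>R x) = (\<Sum>v\<in>A. u v *\<^sub>R f v)"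
    using injA by (simp add: sum.reindex)
  also have "\<dots> = f (\<Sum>v\<in>A. u v *\<^sub>R v)"
    by (simp add: linear_sum[OF f] linear_scale[OF f])
  also have "\<dots> = 0" using A(3) linear_0[OF f] by simp
  finally have "u (inv_into A f (f a)) = 0"
    using independentD[OF ind, of "f ` A" "\<lambda>x. u (inv_into A f x)" "f a"] A by auto
  then show "u a = 0" using injA A(4) by simp
qed

section \<open>The column space of the moment matrix\<close>

definition moment_column :: "('n list \<Rightarrow> real) \<Rightarrow> 'n list \<Rightarrow> 'n list \<Rightarrow> real" where
  "moment_column y w = (\<lambda>u. moment_matrix y u w)"

text \<open>Acting on the row index makes the shift well defined and linear on all functions,
  however a vector is written through columns. The reversal matches the \<open>rev u\<close> in
  \<open>moment_matrix\<close>.\<close>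

definition left_shift :: "'n list \<Rightarrow> ('n list \<Rightarrow> real) \<Rightarrow> 'n list \<Rightarrow> real" where
  "left_shift w f = (\<lambda>u. f (rev w @ u))"

definition right_shift :: "'n list \<Rightarrow> ('n list \<Rightarrow> real) \<Rightarrow> 'n list \<Rightarrow> real" where
  "right_shift w f = (\<lambda>u. f (u @ rev w))"

lemma linear_left_shift: "linear (left_shift w)"
  by (rule linearI) (auto simp: left_shift_def scaleR_fun_def)

lemma linear_right_shift: "linear (right_shift w)"
  by (rule linearI) (auto simp: right_shift_def scaleR_fun_def)

lemma left_shift_column: "left_shift w (moment_column y v) = moment_column y (w @ v)"
  by (simp add: left_shift_def moment_column_def moment_matrix_def)

lemma tracial_rotate: "tracial_sequence y \<Longrightarrow> y (u @ v) = y (v @ u)"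
  unfolding tracial_sequence_def cyc_equiv_def by (metis rotate_append)

text \<open>The shifted entry is \<open>y (w @ rev u @ v)\<close>, and cyclic invariance moves
  \<open>w\<close> to the end.\<close>

lemma right_shift_column:
  "tracial_sequence y \<Longrightarrow> right_shift w (moment_column y v) = moment_column y (v @ w)"
  using tracial_rotate[of y w "rev _ @ v"]
  by (simp add: right_shift_def moment_column_def moment_matrix_def)

lemma moment_column_sym: "tracial_sequence y \<Longrightarrow> moment_column y v u = moment_column y u v"
  unfolding tracial_sequence_def moment_column_def moment_matrix_def
  by (metis rev_append rev_rev_ident)

text \<open>Finiteness of \<open>S\<close> makes \<open>t\<close> a finite number \<open>d\<close>.
  Then \<open>d\<close> independent truncated columns from \<open>S\<close> lift to \<open>d\<close>
  independent full columns, which must span the column space of dimension \<open>d\<close>.\<close>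

lemma moment_matrix_spanned_by_block:
  assumes t: "rank_on UNIV (moment_matrix y) = t" and S: "rank_on S (moment_matrix y) = t" "finite S"
  shows "\<exists>d. t = enat d \<and> (\<exists>X. finite X \<and> card X \<le> d \<and> range (moment_column y) \<subseteq> span X) \<and>
    range (moment_column y) \<subseteq> span (moment_column y ` S)"
proof -
  let ?c = "moment_column y"
  define \<rho> :: "('a list \<Rightarrow> real) \<Rightarrow> 'a list \<Rightarrow> real" where "\<rho> f = (\<lambda>u. if u \<in> S then f u else 0)" for f
  have linear_\<rho>: "linear \<rho>" by (rule linearI) (auto simp: \<rho>_def scaleR_fun_def fun_eq_iff)
  have cols: "columns_on UNIV (moment_matrix y) = range ?c" "columns_on S (moment_matrix y) = \<rho> ` ?c ` S"
    by (auto simp: columns_on_def moment_column_def \<rho>_def image_image)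
  have fin: "finite (\<rho> ` ?c ` S)" using S by simp
  then have "\<exists>B. finite B \<and> span B = span (columns_on S (moment_matrix y))" unfolding cols by blast
  then have tS: "t = enat (dim (\<rho> ` ?c ` S))" using S(1) by (simp add: rank_on_def cols)
  then obtain B where B: "finite B" "span B = span (range ?c)" and tU: "t = enat (dim (range ?c))"
    using t by (auto simp: rank_on_def cols split: if_splits)
  define d where "d = dim (range ?c)"
  have dS: "dim (\<rho> ` ?c ` S) = d" using tS tU by (simp add: d_def)
  obtain X where X: "X \<subseteq> range ?c" "independent X" "range ?c \<subseteq> span X" "card X = d"
    unfolding d_def using basis_exists by blast
  \<comment> \<open>Infinite sets have \<open>card\<close> 0, so finiteness of \<open>X\<close> has
    to come from the finite spanning set \<open>B\<close>.\<close>
  have finX: "finite X"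
    using independent_span_bound[OF B(1) X(2)] X(1) B(2) span_superset[of "range ?c"] by auto
  obtain T where T: "T \<subseteq> \<rho> ` ?c ` S" "independent T" "\<rho> ` ?c ` S \<subseteq> span T" "card T = d"
    unfolding dS[symmetric] using basis_exists by blast
  \<comment> \<open>One full column is selected for each truncated column in
    \<open>T\<close>.\<close>
  obtain Y where Y: "Y \<subseteq> ?c ` S" "inj_on \<rho> Y" "T = \<rho> ` Y"
    using T(1) subset_image_inj by metis
  have indY: "independent Y"
    using independent_of_image[OF linear_\<rho> _ Y(2)] T(2) Y(3) by simp
  have "range ?c \<subseteq> span Y"
  proof (rule ccontr)
    assume "\<not> ?thesis"
    then obtain f where f: "f \<in> range ?c" "f \<notin> span Y" by auto
    then have ind: "independent (insert f Y)" "f \<notin> Y" using indY independent_insertI span_base by auto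
    have "card Y = d" using T(4) Y card_image by metis
    moreover have "insert f Y \<subseteq> span X" using f(1) Y(1) X(3) by blast
    ultimately show False
      using independent_span_bound[OF finX ind(1)] X(4) ind(2) by auto
  qed
  then have "range ?c \<subseteq> span (?c ` S)" using span_mono[OF Y(1)] by blast
  then show ?thesis using finX X tU by (auto simp: d_def intro!: exI[of _ X])
qed

text \<open>In the application \<open>S\<close> consists of the words of length at most
  \<open>N\<close>, and \<open>d\<close> is the rank of the infinite matrix.\<close>

locale spanned_moments =
  fixes y :: "'n list \<Rightarrow> real" and S :: "'n list set" and d :: nat
  assumes tracial: "tracial_sequence y"
    and finite_S: "finite S"
    and psd: "psd_on S (moment_matrix y)"
    and spanned: "range (moment_column y) \<subseteq> span (moment_column y ` S)"
    and bound: "\<exists>X. finite X \<and> card X \<le> d \<and> range (moment_column y) \<subseteq> span X"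
begin

abbreviation "column \<equiv> moment_column y"

definition column_space :: "('n list \<Rightarrow> real) set" where
  "column_space = span (range column)"

definition coeff :: "('n list \<Rightarrow> real) \<Rightarrow> 'n list \<Rightarrow> real" where
  "coeff f = (SOME p. f = (\<Sum>u\<in>S. p u *\<^sub>R column u))"

text \<open>The chosen coefficients are not unique, but the value does not depend on them: see \<open>form_column\<close>.\<close>

definition form :: "('n list \<Rightarrow> real) \<Rightarrow> ('n list \<Rightarrow> real) \<Rightarrow> real" where
  "form f g = (\<Sum>u\<in>S. coeff f u * g u)"

lemma column_space_eq: "column_space = span (column ` S)"
  unfolding column_space_def
  using spanned by (metis image_mono span_eq span_mono subset_UNIV span_superset order_trans)

lemma column_in: "column w \<in> column_space"
  by (simp add: column_space_def span_base)

lemma coeff: "f \<in> column_space \<Longrightarrow> f = (\<Sum>u\<in>S. coeff f u *\<^sub>R column u)"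
  unfolding coeff_def column_space_eq in_span_image_iff[OF finite_S] by (erule someI_ex)

lemma coeff_apply: "f \<in> column_space \<Longrightarrow> f w = (\<Sum>u\<in>S. coeff f u * column u w)"
  by (subst coeff) (simp_all add: sum_fun_apply scaleR_fun_def)

text \<open>Expresses the form through the block on \<open>S\<close> alone, so that
  \<open>psd\<close> applies and symmetry of the matrix carries over.\<close>

lemma form_columns:
  "g \<in> column_space \<Longrightarrow> form f g = (\<Sum>u\<in>S. \<Sum>v\<in>S. coeff f u * moment_matrix y u v * coeff g v)"
  unfolding form_def
  by (intro sum.cong refl)
    (simp add: coeff_apply[of g] moment_column_def sum_distrib_left mult.assoc mult.commute[of "coeff g _"])

lemma form_sym: "f \<in> column_space \<Longrightarrow> g \<in> column_space \<Longrightarrow> form f g = form g f"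
proof -
  have "moment_matrix y u v = moment_matrix y v u" for u v
    using moment_column_sym[OF tracial, of u v] by (simp add: moment_column_def)
  then show "form f g = form g f" if "f \<in> column_space" "g \<in> column_space"
    using that by (simp add: form_columns, subst sum.swap) (simp add: ac_simps)
qed

text \<open>A reproducing-kernel identity, due to the symmetry of the moment matrix.\<close>

lemma form_column: "f \<in> column_space \<Longrightarrow> form f (column w) = f w"
  by (simp add: form_def coeff_apply[of f] moment_column_sym[OF tracial, of w])

lemma form_add: "form f (g + h) = form f g + form f h"
  by (simp add: form_def sum.distrib algebra_simps)

lemma form_scale: "form f (c *\<^sub>R g) = c * form f g"
  by (simp add: form_def scaleR_fun_def sum_distrib_left algebra_simps)

lemma form_nonneg: "f \<in> column_space \<Longrightarrow> 0 \<le> form f f"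
  using psd by (simp add: form_columns psd_on_def)

text \<open>Positivity of the form on \<open>column w - r f\<close> for every real \<open>r\<close> forces \<open>f w = 0\<close>.\<close>

lemma form_definite:
  assumes "f \<in> column_space" "form f f = 0"
  shows "f = 0"
proof
  fix w
  note V = assms(1) column_in[of w]
  \<comment> \<open>The term quadratic in \<open>r\<close> drops out because
    \<open>form f f = 0\<close>.\<close>
  have "0 \<le> form (column w) (column w) - 2 * r * f w" for r
  proof -
    define g where "g = column w + (- r) *\<^sub>R f"
    have g: "g \<in> column_space"
      using V unfolding column_space_def g_def by (intro span_add span_scale)
    have expand: "form h g = form h (column w) + (- r) * form h f" for h
      unfolding g_def form_add form_scale ..
    have "form (column w) f = f w"
      using form_sym[OF V(2,1)] form_column[OF V(1)] by (rule trans)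
    then have "form g (column w) = form (column w) (column w) - r * f w"
      using form_sym[OF g V(2)] expand[of "column w"] by simp
    moreover have "form g f = f w"
      using form_sym[OF g V(1)] expand[of f] assms(2) form_column[OF V(1)] by simp
    ultimately show ?thesis
      using form_nonneg[OF g] expand[of g] by simp
  qed
  \<comment> \<open>If \<open>f w\<close> is nonzero, this \<open>r\<close> turns the right side
    into -1.\<close>
  from this[of "(form (column w) (column w) + 1) / (2 * f w)"]
  have "f w = 0" by (cases "f w = 0") simp_all
  then show "f w = 0 w" by simp
qed

lemma linear_image_in:
  assumes "linear h" "\<And>v. h (column v) \<in> range column" "f \<in> column_space"
  shows "h f \<in> column_space"
proof -
  have "h f \<in> span (h ` range column)"
    using assms(3) unfolding column_space_def linear_span_image[OF assms(1)] by (rule imageI)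
  also have "\<dots> \<subseteq> column_space"
    unfolding column_space_def using assms(2) by (intro span_mono) blast
  finally show ?thesis .
qed

lemma left_shift_in: "f \<in> column_space \<Longrightarrow> left_shift w f \<in> column_space"
  by (rule linear_image_in[OF linear_left_shift]) (auto simp: left_shift_column)

lemma right_shift_in: "f \<in> column_space \<Longrightarrow> right_shift w f \<in> column_space"
  by (rule linear_image_in[OF linear_right_shift]) (auto simp: right_shift_column[OF tracial])

text \<open>Linearity in the first argument is not visible from the chosen \<open>coeff\<close>; it
  is obtained in the second argument and transferred by \<open>form_sym\<close>.\<close>

lemma form_sum_left:
  assumes "\<And>u. u \<in> S \<Longrightarrow> h u \<in> column_space" "g \<in> column_space"
  shows "form (\<Sum>u\<in>S. p u *\<^sub>R h u) g = (\<Sum>u\<in>S. p u * form (h u) g)"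
proof -
  have s: "(\<Sum>u\<in>S. p u *\<^sub>R h u) \<in> column_space"
    using assms unfolding column_space_def by (intro span_sum span_scale)
  have "form g (\<Sum>u\<in>S. p u *\<^sub>R h u) = (\<Sum>v\<in>S. \<Sum>u\<in>S. coeff g v * (p u * h u v))"
    by (simp add: form_def sum_fun_apply scaleR_fun_def sum_distrib_left)
  also have "\<dots> = (\<Sum>u\<in>S. p u * form g (h u))"
    by (subst sum.swap) (simp add: form_def sum_distrib_left mult.left_commute)
  finally show ?thesis using form_sym s assms by simp
qed

text \<open>Shifting the columns in the expansion of \<open>f\<close> and pairing with
  \<open>g\<close> evaluates \<open>g\<close> at \<open>w @ u\<close>, which is the value of
  \<open>left_shift (rev w) g\<close> at \<open>u\<close>.\<close>

lemma left_shift_adjoint: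
  assumes "f \<in> column_space" "g \<in> column_space"
  shows "form (left_shift w f) g = form f (left_shift (rev w) g)"
proof -
  have "left_shift w f = (\<Sum>u\<in>S. coeff f u *\<^sub>R column (w @ u))"
    by (subst coeff[OF assms(1)])
      (simp add: linear_sum[OF linear_left_shift] linear_scale[OF linear_left_shift] left_shift_column)
  then show ?thesis
    using assms(2) form_column form_sym[OF column_in assms(2)]
    by (simp add: form_sum_left column_in) (simp add: form_def left_shift_def)
qed

lemma right_shift_adjoint:
  assumes "f \<in> column_space" "g \<in> column_space"
  shows "form (right_shift w f) g = form f (right_shift (rev w) g)"
proof -
  have "right_shift w f = (\<Sum>u\<in>S. coeff f u *\<^sub>R column (u @ w))"
    by (subst coeff[OF assms(1)])
      (simp add: linear_sum[OF linear_right_shift] linear_scale[OF linear_right_shift]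
        right_shift_column[OF tracial])
  then show ?thesis
    using assms(2) form_column form_sym[OF column_in assms(2)]
    by (simp add: form_sum_left column_in) (simp add: form_def right_shift_def)
qed

sublocale bimodule column_space form d left_shift right_shift S
proof (intro bimodule.intro bimodule_axioms.intro inner_product_on.intro)
  show "subspace column_space" by (simp add: column_space_def)
  show "0 < form f f" if "f \<in> column_space" "f \<noteq> 0" for f
    using form_definite[OF that(1)] form_nonneg[OF that(1)] that(2) by force
  show "\<exists>X. finite X \<and> card X \<le> d \<and> column_space \<subseteq> span X"
    using bound span_minimal[OF _ subspace_span] unfolding column_space_def by metis
  show "left_shift [] f = f" "left_shift (v @ w) f = left_shift v (left_shift w f)"
    "left_shift v (right_shift w f) = right_shift w (left_shift v f)" for v w f
    by (simp_all add: left_shift_def right_shift_def)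
  show "form f g = form g f" if "f \<in> column_space" "g \<in> column_space" for f g
    using that by (rule form_sym)
  show "form (left_shift w f) g = form f (left_shift (rev w) g)"
    "form (right_shift w f) g = form f (right_shift (rev w) g)"
    if "f \<in> column_space" "g \<in> column_space" for f g w
    using that by (rule left_shift_adjoint right_shift_adjoint)+
qed (simp_all add: form_add form_scale left_shift_in right_shift_in linear_left_shift
    linear_right_shift)

text \<open>The column of the empty word generates the space; both shifts send it to
  \<open>column w\<close>, and its pairing with that column is \<open>y w\<close>.\<close>

lemma sequence_trace_combination: "trace_combination d y"
proof -
  have "cyclic column_space (column [])"
    unfolding cyclic_def invariant_def
    using column_in left_shift_in right_shift_in subspace_V in_span_image_iff[OF finite_S, of _ column]
    by (auto simp: left_shift_column right_shift_column[OF tracial] column_space_eq[symmetric])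
  moreover obtain s b where "onb column_space s b" using onb_exists[OF subspace_V] by auto
  ultimately have "trace_combination d (\<lambda>w. form (column []) (left_shift w (column [])))"
    by (rule cyclic_trace_combination)
  moreover have "form (column []) (left_shift w (column [])) = y w" for w
    using form_sym[OF column_in column_in, of "[]" w] form_column[OF column_in, of w "[]"]
    by (simp add: left_shift_column) (simp add: moment_column_def moment_matrix_def)
  ultimately show ?thesis by simp
qed

end

section \<open>Assembly of the tracial moment representation\<close>

lemma normalized_trace_one: "1 \<le> s \<Longrightarrow> normalized_trace (1\<^sub>m s) = 1"
  by (simp add: normalized_trace_def)

theorem corollary3p21:
  fixes y :: "'n::finite list \<Rightarrow> real" and t :: enat and N :: nat
  assumes "tracial_sequence y"
    and "t = rank_on UNIV (moment_matrix y)"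
    and "rank_on (words_upto N) (moment_matrix y) = t"
    and "psd_on (words_upto N) (moment_matrix y)"
    and "flat_extension (words_upto N) (moment_matrix y) (words_upto (N + 1)) (moment_matrix y)"
  shows "tracial_moment_representation t y"
proof -
  have fin: "finite (words_upto N :: 'n list set)"
    using finite_lists_length_le[of "UNIV :: 'n set" N] by (simp add: words_upto_def)
  obtain d where d: "t = enat d"
    "\<exists>X. finite X \<and> card X \<le> d \<and> range (moment_column y) \<subseteq> span X"
    "range (moment_column y) \<subseteq> span (moment_column y ` words_upto N)"
    using moment_matrix_spanned_by_block[OF assms(2)[symmetric] assms(3) fin] by blast
  interpret spanned_moments y "words_upto N" d
    using assms(1,4) fin d by unfold_locales
  obtain m :: nat and s A l where rep:
    "\<forall>i<m. 1 \<le> s i \<and> s i \<le> d \<and> symmetric_tuple (s i) (A i) \<and> 0 \<le> l i"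
    "\<forall>w. y w = (\<Sum>i<m. l i * normalized_trace (word_eval (s i) (A i) w))"
    using sequence_trace_combination unfolding trace_combination_def by blast
  \<comment> \<open>At the empty word each normalized trace is 1, because the sizes are positive, so
    the weights sum to \<open>y []\<close>.\<close>
  have "1 = y []" using assms(1) by (simp add: tracial_sequence_def)
  also have "\<dots> = (\<Sum>i<m. l i)"
    using rep by (simp add: word_eval_def normalized_trace_one)
  finally show ?thesis
    using rep unfolding tracial_moment_representation_def d(1)
    by (intro exI[of _ m] exI[of _ s] exI[of _ A] exI[of _ l]) simp
qed

end
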